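(* Let $q$ be a prime power, let $n\ge k\ge1$ be integers, and let $\mathcal{C}$ be an $[n,k,d]_q$ minimal code. Then $n\ge (q+1)(k-1)$.
   Context: For $v\in\mathbb{F}_q^n$, the support is $\sigma(v)=\{i : v_i\ne 0\}$ and the weight is $\omega(v)=|\sigma(v)|$. An $[n,k,d]_q$ code is an $\mathbb{F}_q$-linear subspace $\mathcal{C}\subseteq\mathbb{F}_q^n$ of dimension $k\ge 1$ with minimum distance $d=\min\{\omega(c): c\in\mathcal{C},\ c\neq 0\}$. A nonzero codeword $c\in\mathcal{C}$ is minimal if every $c'\in\mathcal{C}$ with $\sigma(c')\subseteq\sigma(c)$ is a scalar multiple of $c$. The code $\mathcal{C}$ is minimal if all its nonzero codewords are minimal. *)

theory Defs
  imports "HOL-Analysis.Analysis" "HOL-Number_Theory.Number_Theory"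
begin

(* Vectors of F_q^n are elements of 'a ^ 'n, where 'a is a finite field with CARD('a) = q
   and CARD('n) = n. Linear algebra over 'a is the library's interpretation "vec" of
   finite-dimensional vector spaces, with scalar multiplication *s. *)

definition supp :: "'a::zero ^ 'n \<Rightarrow> 'n set" where
  "supp v = {i. v $ i \<noteq> 0}"

definition weight :: "'a::zero ^ 'n \<Rightarrow> nat" where
  "weight v = card (supp v)"

(* Only meaningful for C containing a nonzero vector; linear_code guarantees this
   through k >= 1. *)
definition min_distance :: "('a::zero ^ 'n) set \<Rightarrow> nat" where
  "min_distance C = Min {weight c | c. c \<in> C \<and> c \<noteq> 0}"

definition linear_code :: "nat \<Rightarrow> nat \<Rightarrow> nat \<Rightarrow> nat \<Rightarrow> ('a::{field,finite} ^ 'n) set \<Rightarrow> bool" where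
  "linear_code q n k d C \<longleftrightarrow>
     CARD('a) = q \<and> CARD('n) = n \<and>
     vec.subspace C \<and> vec.dim C = k \<and> k \<ge> 1 \<and> min_distance C = d"

definition minimal_codeword :: "('a::field ^ 'n) set \<Rightarrow> 'a ^ 'n \<Rightarrow> bool" where
  "minimal_codeword C c \<longleftrightarrow>
     c \<in> C \<and> c \<noteq> 0 \<and> (\<forall>c'\<in>C. supp c' \<subseteq> supp c \<longrightarrow> (\<exists>a. c' = a *s c))"

definition minimal_code :: "('a::field ^ 'n) set \<Rightarrow> bool" where
  "minimal_code C \<longleftrightarrow> (\<forall>c\<in>C. c \<noteq> 0 \<longrightarrow> minimal_codeword C c)"

end

theory Submission imports Defs begin

text \<open>Put \<open>m = k - 1\<close>. Let \<open>c\<close> be a codeword of minimum weight \<open>d\<close> and, for \<open>e \<in> C\<close>, let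
  \<open>N e l\<close> count the coordinates in \<open>supp c\<close> where \<open>e = l c\<close>. Choose \<open>e\<close>, not a multiple of
  \<open>c\<close>, with \<open>N e 0\<close> minimal. Discarding \<open>N e 0 - 1\<close> points of \<open>supp c\<close> still leaves an affine
  blocking set, so Jamison's theorem gives \<open>d - N e 0 \<ge> m (q - 1)\<close>. By pigeonhole \<open>N e l \<ge> m\<close>
  for some \<open>l\<close>, and as \<open>e - l c\<close> has weight at least \<open>d\<close>, the codeword \<open>e\<close> has at least \<open>m\<close>
  nonzero entries outside \<open>supp c\<close>. Hence \<open>e\<close> has weight at least \<open>m (q - 1) + m\<close>, whereas
  every nonzero codeword of a minimal code has at least \<open>m\<close> zeros.\<close>

section \<open>Power sums and sums of products of affine forms over a finite field\<close>

text \<open>For positive \<open>k\<close> the polynomial \<open>p\<close> has too few roots to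
  vanish at every nonzero point. So some \<open>g \<noteq> 0\<close> has
  \<open>g ^ k \<noteq> 1\<close>, and substituting \<open>g * t\<close> for \<open>t\<close>
  multiplies the sum by \<open>g ^ k\<close> without changing it.\<close>

lemma finite_field_power_sum_eq_0:
  assumes "k < CARD('a::{field,finite}) - 1"
  shows "(\<Sum>t\<in>UNIV. t ^ k) = (0::'a)"
proof (cases "k = 0")
  case True
  have "(\<Sum>t\<in>UNIV. t + 1) = (\<Sum>t\<in>UNIV. t :: 'a)"
    by (rule sum.reindex_bij_witness[of _ "\<lambda>t. t - 1" "\<lambda>t. t + 1"]) auto
  then show ?thesis
    by (simp add: sum.distrib True)
next
  case False
  define p :: "'a poly" where "p = Polynomial.monom 1 k - 1"
  have "degree p \<le> k"
    unfolding p_def by (rule degree_diff_le) (auto simp: degree_monom_le)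
  have "Polynomial.coeff p k = 1"
    using False by (simp add: p_def)
  then have "p \<noteq> 0" by auto
  have "card {x. poly p x = 0} \<le> k"
    using card_poly_roots_bound[OF \<open>p \<noteq> 0\<close>] \<open>degree p \<le> k\<close> by linarith
  moreover have "card (UNIV - {0::'a}) = CARD('a) - 1"
    by simp
  ultimately have "\<not> UNIV - {0} \<subseteq> {x. poly p x = 0}"
    using card_mono[of "{x. poly p x = 0}" "UNIV - {0}"] assms by fastforce
  then obtain g :: 'a where "g \<noteq> 0" "g ^ k \<noteq> 1"
    by (auto simp: p_def poly_monom)
  have "(\<Sum>t\<in>UNIV. (g * t) ^ k) = (\<Sum>t\<in>UNIV. t ^ k)"
    by (rule sum.reindex_bij_witness[of _ "\<lambda>t. t / g" "\<lambda>t. g * t"])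
      (use \<open>g \<noteq> 0\<close> in auto)
  then have "g ^ k * (\<Sum>t\<in>UNIV. t ^ k) = (\<Sum>t\<in>UNIV. t ^ k)"
    by (simp add: power_mult_distrib sum_distrib_left)
  then show ?thesis
    using \<open>g ^ k \<noteq> 1\<close> by simp
qed

lemma sum_PiE_insert:
  assumes "j \<notin> J"
  shows "(\<Sum>x\<in>PiE (insert j J) A. f x) = (\<Sum>x\<in>PiE J A. \<Sum>t\<in>A j. f (x(j := t)))"
proof -
  have "(\<Sum>x\<in>PiE (insert j J) A. f x) = (\<Sum>(t, x)\<in>A j \<times> PiE J A. f (x(j := t)))"
    unfolding PiE_insert_eq
    by (subst sum.reindex[OF inj_combinator[OF assms]]) (simp add: case_prod_unfold)
  also have "\<dots> = (\<Sum>t\<in>A j. \<Sum>x\<in>PiE J A. f (x(j := t)))"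
    by (rule sum.cartesian_product[symmetric])
  finally show ?thesis
    by (simp add: sum.swap[of _ "PiE J A"])
qed

text \<open>As in the Chevalley-Warning theorem: the product has degree at most
  \<open>card I\<close> in the variables \<open>x j\<close>, so each monomial has a variable of
  exponent below \<open>CARD('a) - 1\<close>, whose power sum vanishes.\<close>

lemma sum_prod_affine_eq_0:
  fixes c :: "'i \<Rightarrow> 'a::{field,finite}" and a :: "'j \<Rightarrow> 'i \<Rightarrow> 'a"
  assumes "finite J" "finite I" "card I < card J * (CARD('a) - 1)"
  shows "(\<Sum>x\<in>J \<rightarrow>\<^sub>E UNIV. \<Prod>i\<in>I. c i + (\<Sum>j\<in>J. x j * a j i)) = 0"
  using assms
proof (induction J arbitrary: I rule: finite_induct)
  case empty
  then show ?case by simp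
next
  case (insert j J)
  define u where "u x i = c i + (\<Sum>l\<in>J. x l * a l i)" for x i
  have upd: "c i + (\<Sum>l\<in>insert j J. (x(j := t)) l * a l i) = t * a j i + u x i" for x t i
  proof -
    have "(\<Sum>l\<in>J. (x(j := t)) l * a l i) = (\<Sum>l\<in>J. x l * a l i)"
      using insert.hyps by (intro sum.cong) auto
    then show ?thesis
      using insert.hyps by (simp add: u_def)
  qed
  have "(\<Sum>x\<in>insert j J \<rightarrow>\<^sub>E UNIV. \<Prod>i\<in>I. c i + (\<Sum>l\<in>insert j J. x l * a l i))
      = (\<Sum>x\<in>J \<rightarrow>\<^sub>E UNIV. \<Sum>t\<in>UNIV. \<Prod>i\<in>I. t * a j i + u x i)"
    unfolding sum_PiE_insert[OF insert.hyps(2)] upd ..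
  \<comment> \<open>\<open>A\<close> collects the factors contributing their \<open>t\<close>-term,
    so \<open>card A\<close> is the exponent of \<open>t\<close>.\<close>
  also have "\<dots> = (\<Sum>x\<in>J \<rightarrow>\<^sub>E UNIV. \<Sum>t\<in>UNIV. \<Sum>A\<in>Pow I.
      t ^ card A * (\<Prod>i\<in>A. a j i) * (\<Prod>i\<in>I - A. u x i))"
    using insert.prems by (simp add: prod_add prod.distrib)
  also have "\<dots> = (\<Sum>A\<in>Pow I. \<Sum>x\<in>J \<rightarrow>\<^sub>E UNIV. \<Sum>t\<in>UNIV.
      t ^ card A * (\<Prod>i\<in>A. a j i) * (\<Prod>i\<in>I - A. u x i))"
    by (simp only: sum.swap[of _ _ "Pow I"])
  also have "\<dots> = (\<Sum>A\<in>Pow I. (\<Sum>t\<in>UNIV. t ^ card A) * (\<Prod>i\<in>A. a j i)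
      * (\<Sum>x\<in>J \<rightarrow>\<^sub>E UNIV. \<Prod>i\<in>I - A. u x i))"
    by (simp add: sum_distrib_left sum_distrib_right)
  also have "\<dots> = 0"
  proof (intro sum.neutral ballI)
    fix A assume "A \<in> Pow I"
    show "(\<Sum>t\<in>UNIV. t ^ card A) * (\<Prod>i\<in>A. a j i)
      * (\<Sum>x\<in>J \<rightarrow>\<^sub>E UNIV. \<Prod>i\<in>I - A. u x i) = 0"
    \<comment> \<open>A small exponent makes the power sum of \<open>t\<close> vanish; a large one
      leaves few enough factors for the induction hypothesis.\<close>
    proof (cases "card A < CARD('a) - 1")
      case True
      then show ?thesis
        by (simp add: finite_field_power_sum_eq_0)
    next
      case False
      have "card (I - A) = card I - card A"
        using \<open>A \<in> Pow I\<close> insert.prems by (auto simp: card_Diff_subset finite_subset)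
      moreover have "card A \<le> card I"
        using \<open>A \<in> Pow I\<close> insert.prems by (auto simp: card_mono)
      ultimately have "card (I - A) < card J * (CARD('a) - 1)"
        using False insert.prems insert.hyps by simp
      then have "(\<Sum>x\<in>J \<rightarrow>\<^sub>E UNIV. \<Prod>i\<in>I - A. u x i) = 0"
        using insert.IH[of "I - A"] insert.prems by (simp add: u_def)
      then show ?thesis by simp
    qed
  qed
  finally show ?case .
qed

section \<open>Codewords vanishing on given coordinates\<close>

lemma subspace_vanishing_on:
  assumes "vec.subspace (C :: ('a::field ^ 'n) set)"
  shows "vec.subspace {e \<in> C. \<forall>i\<in>Z. e $ i = 0}"
  using assms by (auto simp: vec.subspace_def)

lemma dim_le_dim_vanishing_at:
  assumes C: "vec.subspace (C :: ('a::field ^ 'n) set)"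
  shows "vec.dim C \<le> vec.dim {e \<in> C. e $ i = 0} + 1"
proof (cases "\<exists>c\<in>C. c $ i \<noteq> 0")
  case True
  then obtain c where c: "c \<in> C" "c $ i \<noteq> 0" by auto
  let ?W = "{e \<in> C. e $ i = 0}"
  have "C \<subseteq> vec.span (insert c ?W)"
  proof
    fix e assume "e \<in> C"
    then have "e - (e $ i / c $ i) *s c \<in> ?W"
      using c C by (auto intro: vec.subspace_diff vec.subspace_scale)
    then show "e \<in> vec.span (insert c ?W)"
      unfolding vec.span_insert by (blast intro: vec.span_base)
  qed
  then have "vec.dim C \<le> vec.dim (insert c ?W)"
    by (rule vec.dim_mono)
  then show ?thesis
    by (simp add: vec.dim_insert split: if_splits)
next
  case False
  then have "{e \<in> C. e $ i = 0} = C" by auto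
  then show ?thesis by simp
qed

lemma dim_le_dim_vanishing_on:
  assumes "vec.subspace (C :: ('a::field ^ 'n) set)" "finite Z"
  shows "vec.dim C \<le> vec.dim {e \<in> C. \<forall>i\<in>Z. e $ i = 0} + card Z"
  using assms(2)
proof (induction Z rule: finite_induct)
  case empty
  then show ?case by simp
next
  case (insert i Z)
  have "{e \<in> {e \<in> C. \<forall>i\<in>Z. e $ i = 0}. e $ i = 0} = {e \<in> C. \<forall>i\<in>insert i Z. e $ i = 0}"
    by auto
  then show ?case
    using insert dim_le_dim_vanishing_at[OF subspace_vanishing_on[OF assms(1), of Z], of i]
    by simp
qed

section \<open>Weights in minimal codes\<close>

lemma minimal_codeD:
  assumes "minimal_code C" "c \<in> C" "c \<noteq> 0" "e \<in> C" "supp e \<subseteq> supp c"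
  shows "\<exists>a. e = a *s c"
  using assms by (auto simp: minimal_code_def minimal_codeword_def)

text \<open>Each zero of \<open>c\<close> imposes one linear condition on \<open>C\<close>, and by
  minimality all these conditions together leave only the multiples of \<open>c\<close>.\<close>

lemma minimal_code_weight_le:
  fixes C :: "('a::field ^ 'n) set"
  assumes "vec.subspace C" "minimal_code C" "c \<in> C" "c \<noteq> 0"
  shows "weight c + (vec.dim C - 1) \<le> CARD('n)"
proof -
  let ?D = "{e \<in> C. \<forall>i\<in>-supp c. e $ i = 0}"
  have "?D \<subseteq> vec.span {c}"
    using minimal_codeD[OF assms(2-4)] by (fastforce simp: supp_def vec.span_singleton)
  then have "vec.dim ?D \<le> 1"
    using vec.dim_le_card[of ?D "{c}"] by simp
  then have "vec.dim C \<le> 1 + card (- supp c)"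
    using dim_le_dim_vanishing_on[OF assms(1), of "- supp c"] by simp
  moreover have "weight c + card (- supp c) = CARD('n)"
    by (simp add: weight_def Compl_eq_Diff_UNIV card_Diff_subset card_mono)
  ultimately show ?thesis by simp
qed

section \<open>Affine blocking sets\<close>

text \<open>Jamison's theorem on affine blocking sets: the coordinates in \<open>supp c\<close> are points of
  the affine space in which \<open>c\<close> defines the hyperplane at infinity, and the zeros of the
  remaining codewords are its affine hyperplanes.\<close>

lemma card_blocking_set:
  fixes C :: "('a::{field,finite} ^ 'n) set"
  assumes C: "vec.subspace C" and c: "c \<in> C" and T: "T \<subseteq> supp c" "T \<noteq> {}"
    and block: "\<And>e. e \<in> C \<Longrightarrow> \<nexists>a. e = a *s c \<Longrightarrow> \<exists>i\<in>T. e $ i = 0"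
  shows "(vec.dim C - 1) * (CARD('a) - 1) < card T"
proof (rule ccontr)
  assume small: "\<not> ?thesis"
  obtain i0 where i0: "i0 \<in> T" "c $ i0 \<noteq> 0"
    using T by (auto simp: supp_def)
  \<comment> \<open>With \<open>i0\<close> as origin, the affine hyperplanes missing it are, up to
    scaling, the zeros of \<open>c + w\<close> with nonzero \<open>w \<in> W\<close>.\<close>
  define W where "W = {e \<in> C. e $ i0 = 0}"
  have W: "vec.subspace W"
    using subspace_vanishing_on[OF C, of "{i0}"] by (simp add: W_def)
  obtain B where B: "B \<subseteq> W" "vec.independent B" "card B = vec.dim W"
    using vec.basis_exists[of W] by metis
  let ?f = "\<lambda>x i. c $ i + (\<Sum>b\<in>B. x b * b $ i)"
  let ?I = "T - {i0}"
  let ?z = "\<lambda>b\<in>B. 0 :: 'a"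
  have "card ?I < card T"
    using i0 by (intro psubset_card_mono) auto
  also have "card T \<le> (vec.dim C - 1) * (CARD('a) - 1)"
    using small by simp
  also have "\<dots> \<le> card B * (CARD('a) - 1)"
    using dim_le_dim_vanishing_at[OF C, of i0] B(3) by (intro mult_right_mono) (auto simp: W_def)
  finally have "(\<Sum>x\<in>B \<rightarrow>\<^sub>E UNIV. \<Prod>i\<in>?I. ?f x i) = 0"
    by (intro sum_prod_affine_eq_0) auto
  \<comment> \<open>\<open>?f x\<close> lists the entries of \<open>c + w\<close>, where
    \<open>w\<close> has coordinates \<open>x\<close> in the basis \<open>B\<close>. For
    \<open>w \<noteq> 0\<close> the blocking property yields a zero in \<open>T\<close>, which is
    not \<open>i0\<close>.\<close>
  moreover have "(\<Prod>i\<in>?I. ?f x i) = 0" if x: "x \<in> (B \<rightarrow>\<^sub>E UNIV) - {?z}" for x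
  proof -
    define w where "w = (\<Sum>b\<in>B. x b *s b)"
    have "w \<in> W"
      unfolding w_def using B(1) by (auto intro!: vec.subspace_sum[OF W] vec.subspace_scale[OF W])
    have "w \<noteq> 0"
    proof
      assume "w = 0"
      then have "\<forall>b\<in>B. x b = 0"
        using vec.independentD[OF B(2) _ subset_refl, of x] by (simp add: w_def)
      then show False
        using x by (auto simp: PiE_iff extensional_def fun_eq_iff split: if_splits)
    qed
    have "\<nexists>a. c + w = a *s c"
    proof
      assume "\<exists>a. c + w = a *s c"
      then obtain a where a: "c + w = a *s c" ..
      then have "(c + w) $ i0 = (a *s c) $ i0" by simp
      then have "a = 1"
        using \<open>w \<in> W\<close> i0 by (simp add: W_def)
      then show False
        using a \<open>w \<noteq> 0\<close> by simp
    qed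
    moreover have "c + w \<in> C"
      using C c \<open>w \<in> W\<close> by (auto simp: W_def vec.subspace_add)
    ultimately obtain i where i: "i \<in> T" "(c + w) $ i = 0"
      using block by blast
    then have "i \<noteq> i0"
      using \<open>w \<in> W\<close> i0 by (auto simp: W_def)
    moreover have "?f x i = 0"
      using i by (simp add: w_def)
    ultimately show ?thesis
      using i(1) by (intro prod_zero) auto
  qed
  \<comment> \<open>Only the term at the zero vector survives in the sum, and it is a product of
    nonzero entries of \<open>c\<close>.\<close>
  ultimately have "(\<Prod>i\<in>?I. ?f ?z i) = 0"
    by (subst (asm) sum.remove[of _ ?z]) (auto simp: finite_PiE)
  then show False
    using T by (auto simp: supp_def)
qed

section \<open>The length bound\<close>

theorem theorem2p14:
  fixes q n k d :: nat and C :: "('a::{field,finite} ^ 'n) set"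
  assumes "primepow q"
    and "n \<ge> k" and "k \<ge> 1"
    and "linear_code q n k d C"
    and "minimal_code C"
  shows "n \<ge> (q + 1) * (k - 1)"
proof (cases "k = 1")
  case True
  then show ?thesis by simp
next
  case False
  define m where "m = k - 1"
  have "m \<ge> 1"
    using False assms(3) by (simp add: m_def)
  have q: "CARD('a) = q" and n: "CARD('n) = n" and C: "vec.subspace C" and k: "vec.dim C = k"
    using assms(4) by (auto simp: linear_code_def)
  have "q \<ge> 2"
    using card_mono[of "UNIV :: 'a set" "{0, 1}"] q by simp
  have not_multiples: "\<exists>e. e \<in> C \<and> (\<nexists>a. e = a *s c)" for c
  proof (rule ccontr)
    assume "\<not> ?thesis"
    then have "C \<subseteq> vec.span {c}"
      by (auto simp: vec.span_singleton)
    then have "vec.dim C \<le> 1"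
      using vec.dim_le_card[of C "{c}"] by simp
    then show False
      using \<open>m \<ge> 1\<close> k by (simp add: m_def)
  qed
  have "\<exists>c. c \<in> C \<and> c \<noteq> 0"
    using not_multiples[of 0] by auto
  then obtain c where c: "c \<in> C" "c \<noteq> 0"
    and c_min: "\<And>e. e \<in> C \<Longrightarrow> e \<noteq> 0 \<Longrightarrow> weight c \<le> weight e"
    using ex_has_least_nat[of "\<lambda>c. c \<in> C \<and> c \<noteq> 0" _ weight] by blast
  define N where "N e l = card {i \<in> supp c. e $ i = l * c $ i}" for e l
  obtain e where e: "e \<in> C" "\<nexists>a. e = a *s c"
    and e_min: "\<And>e'. e' \<in> C \<Longrightarrow> \<nexists>a. e' = a *s c \<Longrightarrow> N e 0 \<le> N e' 0"
    using ex_has_least_nat[of "\<lambda>e. e \<in> C \<and> (\<nexists>a. e = a *s c)" _ "\<lambda>e. N e 0"]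
      not_multiples[of c] by blast
  define r where "r = card (supp e - supp c)"
  have "e \<noteq> 0"
    using e(2) by (metis vec.scale_zero_left)
  have shift_not_0: "e - l *s c \<noteq> 0" for l
    using e(2) by auto

  \<comment> \<open>Subtracting \<open>l *s c\<close> affects only entries in \<open>supp c\<close>,
    exactly \<open>N e l\<close> of which become zero.\<close>
  have weight_shift: "weight (e - l *s c) + N e l = weight c + r" for l
  proof -
    let ?Z = "{i \<in> supp c. e $ i = l * c $ i}"
    have "supp (e - l *s c) = (supp c - ?Z) \<union> (supp e - supp c)"
      by (auto simp: supp_def)
    then have "weight (e - l *s c) = card (supp c - ?Z) + r"
      unfolding weight_def r_def by (simp only:) (rule card_Un_disjoint, auto)
    moreover have "card (supp c - ?Z) + N e l = weight c"
      unfolding N_def weight_def by (subst card_Diff_subset) (auto intro!: le_add_diff_inverse2 card_mono)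
    ultimately show ?thesis by simp
  qed

  \<comment> \<open>Otherwise minimality of \<open>e\<close> would make \<open>c\<close> a multiple
    of \<open>e\<close>, and hence \<open>e\<close> one of \<open>c\<close>.\<close>
  have N_pos: "N e 0 \<ge> 1"
  proof -
    have "\<not> supp c \<subseteq> supp e"
    proof
      assume "supp c \<subseteq> supp e"
      then obtain a where a: "c = a *s e"
        using minimal_codeD[OF assms(5) e(1) \<open>e \<noteq> 0\<close> c(1)] by auto
      then have "e = inverse a *s c"
        using c(2) by (cases "a = 0") auto
      then show False
        using e(2) by blast
    qed
    then have "{i \<in> supp c. e $ i = 0 * c $ i} \<noteq> {}"
      by (auto simp: supp_def)
    then show ?thesis
      unfolding N_def by (simp add: Suc_le_eq card_gt_0_iff)
  qed
  have "N e 0 \<le> weight c"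
    unfolding N_def weight_def by (intro card_mono) auto
  \<comment> \<open>One point fewer than the least number of zeros, so every affine hyperplane keeps
    a point outside \<open>R\<close>.\<close>
  then obtain R where R: "R \<subseteq> supp c" "card R = N e 0 - 1"
    unfolding weight_def by (metis obtain_subset_with_card_n diff_le_self order_trans)
  have card_diff: "card (supp c - R) + (N e 0 - 1) = weight c"
    using R \<open>N e 0 \<le> weight c\<close> by (simp add: card_Diff_subset weight_def)
  have "m * (q - 1) < card (supp c - R)"
  proof -
    have "supp c - R \<noteq> {}"
      using card_diff N_pos \<open>N e 0 \<le> weight c\<close> by fastforce
    moreover have "\<exists>i\<in>supp c - R. e' $ i = 0" if "e' \<in> C" "\<nexists>a. e' = a *s c" for e'
    proof -
      have "card R < card {i \<in> supp c. e' $ i = 0}"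
        using e_min[OF that] R N_pos by (simp add: N_def)
      then have "\<not> {i \<in> supp c. e' $ i = 0} \<subseteq> R"
        by (meson card_mono finite not_less)
      then show ?thesis by auto
    qed
    ultimately show ?thesis
      using card_blocking_set[OF C c(1), of "supp c - R"] q k by (auto simp: m_def)
  qed
  \<comment> \<open>Strictness of the previous bound makes up for the 1 subtracted in
    \<open>card R\<close>.\<close>
  then have outside: "weight c \<ge> m * (q - 1) + N e 0"
    using card_diff N_pos by linarith

  \<comment> \<open>The ratio \<open>e $ i / c $ i\<close> partitions \<open>supp c\<close>.\<close>
  have sum_N: "(\<Sum>l\<in>UNIV. N e l) = weight c"
  proof -
    have "(\<Sum>l\<in>UNIV. N e l) = card (\<Union>l\<in>UNIV. {i \<in> supp c. e $ i = l * c $ i})"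
      unfolding N_def by (rule card_UN_disjoint[symmetric]) (auto simp: supp_def)
    also have "(\<Union>l\<in>UNIV. {i \<in> supp c. e $ i = l * c $ i}) = supp c"
    proof -
      have "i \<in> supp c \<Longrightarrow> e $ i = (e $ i / c $ i) * c $ i" for i
        by (simp add: supp_def)
      then show ?thesis by blast
    qed
    finally show ?thesis by (simp add: weight_def)
  qed
  \<comment> \<open>The \<open>q - 1\<close> nonzero values of \<open>l\<close> share at least
    \<open>m * (q - 1)\<close> coordinates.\<close>
  have "\<exists>l. N e l \<ge> m"
  proof (rule ccontr)
    assume "\<not> ?thesis"
    then have "N e l \<le> m - 1" for l
      by (metis Suc_pred' \<open>m \<ge> 1\<close> less_Suc_eq_le not_le less_eq_Suc_le One_nat_def)
    then have "(\<Sum>l\<in>UNIV - {0}. N e l) \<le> (q - 1) * (m - 1)"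
      using sum_bounded_above[of "UNIV - {0}" "N e" "m - 1"] q by simp
    moreover have "(\<Sum>l\<in>UNIV. N e l) = N e 0 + (\<Sum>l\<in>UNIV - {0}. N e l)"
      by (rule sum.remove) auto
    ultimately have "m * (q - 1) \<le> (q - 1) * (m - 1)"
      using outside sum_N by linarith
    then show False
      using \<open>m \<ge> 1\<close> \<open>q \<ge> 2\<close> by (simp add: mult.commute)
  qed
  then obtain l where l: "N e l \<ge> m" ..
  have "weight c \<le> weight (e - l *s c)"
    using c_min shift_not_0 e c C by (simp add: vec.subspace_diff vec.subspace_scale)
  then have "r \<ge> m"
    using weight_shift[of l] l by linarith
  moreover have "weight e + m \<le> n"
    using minimal_code_weight_le[OF C assms(5) e(1) \<open>e \<noteq> 0\<close>] n k by (simp add: m_def)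
  moreover have "weight e + N e 0 = weight c + r"
    using weight_shift[of 0] by simp
  \<comment> \<open>One \<open>m\<close> comes from \<open>r\<close>, the other from the zeros of
    \<open>e\<close>.\<close>
  ultimately have "n \<ge> m * (q - 1) + 2 * m"
    using outside by linarith
  also have "m * (q - 1) + 2 * m = (q + 1) * m"
    using \<open>q \<ge> 2\<close> by (simp add: algebra_simps diff_mult_distrib2)
  finally show ?thesis
    by (simp add: m_def)
qed

end
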